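(* Let $n\geq 8$ and $a$ be integers with $2\leq a<\frac{n}{2}$ and $(n,a)\neq(8,3)$, and let $\overline{\Gamma}=\overline{C_n(1,a)}$ be the complement of the circulant graph $C_n(1,a)$. Then: (i) $W(\overline{\Gamma})=\frac{n(n+3)}{2}$; (ii) $S(\overline{\Gamma})=n(n-5)(n+3)$; (iii) $G(\overline{\Gamma})=\frac{n(n+3)(n-5)^2}{2}$; (iv) $WW(\overline{\Gamma})=\frac{n(2n+14)}{4}$; (v) $H(\overline{\Gamma})=\frac{n(n-3)}{2}$; (vi) $H_A(\overline{\Gamma})=n(n-5)(n-3)$; (vii) $H_M(\overline{\Gamma})=\frac{n(n-3)(n-5)^2}{2}$; (viii) $T_{AG}(\overline{\Gamma})=\frac{n(n-5)}{2}$; (ix) $T_{GA}(\overline{\Gamma})=\frac{n(n-5)}{2}$; (x) $T_{SC}(\overline{\Gamma})=\frac{n(n-5)}{2\sqrt{2}\sqrt{n+3}}$; (xi) $T_{ABC}(\overline{\Gamma})=\frac{n(n-5)\sqrt{n+2}}{\sqrt{2}(n+3)}$; (xii) $T_{AZ}(\overline{\Gamma})=\frac{n(n-5)(n+3)^6}{16(n+2)^3}$; (xiii) $RT_{AG}(\overline{\Gamma})=\frac{n(n-5)}{2}$; (xiv) $RT_{GA}(\overline{\Gamma})=\frac{n(n-5)}{2}$; (xv) $RT_{SC}(\overline{\Gamma})=\frac{n(n-5)}{2\sqrt{2}\sqrt{n-3}}$; (xvi) $RT_{ABC}(\overline{\Gamma})=\frac{n(n-5)\sqrt{n-4}}{\sqrt{2}(n-3)}$;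 (xvii) $RT_{AZ}(\overline{\Gamma})=\frac{n(n-5)(n-3)^6}{16(n-4)^3}$.
   Context: For $S\subseteq\mathbb{Z}_n\setminus\{0\}$, the circulant graph $C_n(S)$ is the simple undirected graph with vertex set $\mathbb{Z}_n$ and edge set $\{\{g,g+s\}: g\in\mathbb{Z}_n, s\in S\}$ (addition mod $n$); $C_n(1,a)$ means $C_n(\{1,a\})$. $\overline{\Gamma}$ denotes the complement of $\Gamma$. For a connected graph $\Gamma$, let $d(u,v)$ be the shortest-path distance, $\deg(v)$ the degree, $\sigma(v)=\sum_{u\neq v}d(u,v)$ the transmission of $v$, and $rs(v)=\sum_{u\neq v}\frac{1}{d(u,v)}$ the reciprocal transmission of $v$. Below, $\sum_{\{u,v\}}$ is over unordered pairs of distinct vertices and $\sum_{uv\in E}$ is over (undirected) edges of $\Gamma$. The indices are: $W=\sum_{\{u,v\}}d(u,v)$ (Wiener); $WW=\frac12\sum_{\{u,v\}}[d(u,v)+d(u,v)^2]$ (hyper-Wiener); $H=\sum_{\{u,v\}}\frac{1}{d(u,v)}$ (Harary); $S=\sum_{\{u,v\}}[\deg(u)+\deg(v)]d(u,v)$ (Schultz); $G=\sum_{\{u,v\}}\deg(u)\deg(v)d(u,v)$ (Gutman); $H_A=\sum_{\{u,v\}}\frac{\deg(u)+\deg(v)}{d(u,v)}$ and $H_M=\sum_{\{u,v\}}\frac{\deg(u)\deg(v)}{d(u,v)}$ (additively and multiplicatively weighted Harary); $T_{GA}=\sum_{uv\in E}\frac{2\sqrt{\sigma(u)\sigma(v)}}{\sigma(u)+\sigma(v)}$;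 $T_{AG}=\sum_{uv\in E}\frac{\sigma(u)+\sigma(v)}{2\sqrt{\sigma(u)\sigma(v)}}$; $T_{SC}=\sum_{uv\in E}\frac{1}{\sqrt{\sigma(u)+\sigma(v)}}$; $T_{ABC}=\sum_{uv\in E}\sqrt{\frac{\sigma(u)+\sigma(v)-2}{\sigma(u)\sigma(v)}}$; $T_{AZ}=\sum_{uv\in E}\left[\frac{\sigma(u)\sigma(v)}{\sigma(u)+\sigma(v)-2}\right]^3$; and $RT_{GA},RT_{AG},RT_{SC},RT_{ABC},RT_{AZ}$ are defined by the same formulas as $T_{GA},T_{AG},T_{SC},T_{ABC},T_{AZ}$ respectively, with $\sigma$ replaced by $rs$. *)

theory Defs
  imports "Graph_Theory.Graph_Theory"
begin

text \<open>
  A simple undirected graph is a \<open>pair_graph\<close>: a finite, loop-free, symmetric relation on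
  \<open>pverts\<close>, the edge \<open>{u, v}\<close> being the two arcs \<open>(u, v)\<close> and \<open>(v, u)\<close>.
\<close>

subsection \<open>Circulant graphs and complements\<close>

text \<open>
  \<open>\<int>\<^sub>n\<close> is represented by \<open>{0..<n}\<close>, and \<open>S\<close> by integer representatives, none of them
  divisible by \<open>n\<close>.
\<close>

definition circulant :: "int \<Rightarrow> int set \<Rightarrow> int pair_pre_digraph" where
  "circulant n S =
     \<lparr> pverts = {0..<n},
       parcs = {(g, (g + s) mod n) | g s. g \<in> {0..<n} \<and> s \<in> S}
             \<union> {((g + s) mod n, g) | g s. g \<in> {0..<n} \<and> s \<in> S} \<rparr>"

definition graph_compl :: "'a pair_pre_digraph \<Rightarrow> 'a pair_pre_digraph" where
  "graph_compl G =
     \<lparr> pverts = pverts G,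
       parcs = {(u, v). u \<in> pverts G \<and> v \<in> pverts G \<and> u \<noteq> v \<and> (u, v) \<notin> parcs G} \<rparr>"


subsection \<open>Degree, distance and transmissions\<close>

text \<open>In a symmetric digraph the out-degree is the degree of the underlying graph.\<close>

definition deg :: "'a pair_pre_digraph \<Rightarrow> 'a \<Rightarrow> real" where
  "deg G v = real (out_degree (with_proj G) v)"

text \<open>
  \<open>\<mu>\<close> is \<open>\<infinity>\<close> for vertices in different components, which \<open>real_of_ereal\<close> sends to \<open>0\<close>; all
  notions below are meant for connected graphs only.
\<close>

definition gdist :: "'a pair_pre_digraph \<Rightarrow> 'a \<Rightarrow> 'a \<Rightarrow> real" where
  "gdist G u v = real_of_ereal (wf_digraph.\<mu> (with_proj G) (\<lambda>_. 1) u v)"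

definition transmission :: "'a pair_pre_digraph \<Rightarrow> 'a \<Rightarrow> real" where
  "transmission G v = (\<Sum>u\<in>pverts G - {v}. gdist G u v)"

definition recip_transmission :: "'a pair_pre_digraph \<Rightarrow> 'a \<Rightarrow> real" where
  "recip_transmission G v = (\<Sum>u\<in>pverts G - {v}. 1 / gdist G u v)"


subsection \<open>Sums over unordered pairs\<close>

definition vertex_pairs :: "'a pair_pre_digraph \<Rightarrow> 'a set set" where
  "vertex_pairs G = {{u, v} | u v. u \<in> pverts G \<and> v \<in> pverts G \<and> u \<noteq> v}"

definition uedges :: "'a pair_pre_digraph \<Rightarrow> 'a set set" where
  "uedges G = {{u, v} | u v. (u, v) \<in> parcs G}"

text \<open>
  The summand at \<open>{u, v}\<close> is \<open>f u v\<close>, which is meaningful for symmetric \<open>f\<close>.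
\<close>

definition upair_sum :: "('a \<Rightarrow> 'a \<Rightarrow> real) \<Rightarrow> 'a set set \<Rightarrow> real" where
  "upair_sum f P = (\<Sum>e\<in>P. THE y. \<exists>u v. e = {u, v} \<and> y = f u v)"

lemma upair_sum_summand:
  assumes "f u v = f v u"
  shows "(THE y. \<exists>u' v'. {u, v} = {u', v'} \<and> y = f u' v') = f u v"
  using assms by (intro the_equality) (auto simp: doubleton_eq_iff)

subsection \<open>Distance-based indices\<close>

definition wiener :: "'a pair_pre_digraph \<Rightarrow> real" where
  "wiener G = upair_sum (\<lambda>u v. gdist G u v) (vertex_pairs G)"

definition hyper_wiener :: "'a pair_pre_digraph \<Rightarrow> real" where
  "hyper_wiener G =
     1 / 2 * upair_sum (\<lambda>u v. gdist G u v + (gdist G u v)\<^sup>2) (vertex_pairs G)"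

definition harary :: "'a pair_pre_digraph \<Rightarrow> real" where
  "harary G = upair_sum (\<lambda>u v. 1 / gdist G u v) (vertex_pairs G)"

definition schultz :: "'a pair_pre_digraph \<Rightarrow> real" where
  "schultz G = upair_sum (\<lambda>u v. (deg G u + deg G v) * gdist G u v) (vertex_pairs G)"

definition gutman :: "'a pair_pre_digraph \<Rightarrow> real" where
  "gutman G = upair_sum (\<lambda>u v. deg G u * deg G v * gdist G u v) (vertex_pairs G)"

definition harary_add :: "'a pair_pre_digraph \<Rightarrow> real" where
  "harary_add G = upair_sum (\<lambda>u v. (deg G u + deg G v) / gdist G u v) (vertex_pairs G)"

definition harary_mult :: "'a pair_pre_digraph \<Rightarrow> real" where
  "harary_mult G = upair_sum (\<lambda>u v. deg G u * deg G v / gdist G u v) (vertex_pairs G)"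


subsection \<open>Transmission-based indices\<close>

text \<open>
  The edge sums take the vertex weight \<open>w\<close> as a parameter: \<open>w\<close> is the transmission for the
  \<open>T\<close>-indices and the reciprocal transmission for the \<open>RT\<close>-indices.
\<close>

definition GA_index :: "('a \<Rightarrow> real) \<Rightarrow> 'a pair_pre_digraph \<Rightarrow> real" where
  "GA_index w G = upair_sum (\<lambda>u v. 2 * sqrt (w u * w v) / (w u + w v)) (uedges G)"

definition AG_index :: "('a \<Rightarrow> real) \<Rightarrow> 'a pair_pre_digraph \<Rightarrow> real" where
  "AG_index w G = upair_sum (\<lambda>u v. (w u + w v) / (2 * sqrt (w u * w v))) (uedges G)"

definition SC_index :: "('a \<Rightarrow> real) \<Rightarrow> 'a pair_pre_digraph \<Rightarrow> real" where
  "SC_index w G = upair_sum (\<lambda>u v. 1 / sqrt (w u + w v)) (uedges G)"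

definition ABC_index :: "('a \<Rightarrow> real) \<Rightarrow> 'a pair_pre_digraph \<Rightarrow> real" where
  "ABC_index w G = upair_sum (\<lambda>u v. sqrt ((w u + w v - 2) / (w u * w v))) (uedges G)"

definition AZ_index :: "('a \<Rightarrow> real) \<Rightarrow> 'a pair_pre_digraph \<Rightarrow> real" where
  "AZ_index w G = upair_sum (\<lambda>u v. (w u * w v / (w u + w v - 2)) ^ 3) (uedges G)"

definition "T_GA G = GA_index (transmission G) G"
definition "T_AG G = AG_index (transmission G) G"
definition "T_SC G = SC_index (transmission G) G"
definition "T_ABC G = ABC_index (transmission G) G"
definition "T_AZ G = AZ_index (transmission G) G"

definition "RT_GA G = GA_index (recip_transmission G) G"
definition "RT_AG G = AG_index (recip_transmission G) G"
definition "RT_SC G = SC_index (recip_transmission G) G"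
definition "RT_ABC G = ABC_index (recip_transmission G) G"
definition "RT_AZ G = AZ_index (recip_transmission G) G"


subsection \<open>Well-definedness\<close>

lemma gdist_commute:
  assumes "pair_graph G"
  shows "gdist G u v = gdist G v u"
proof -
  interpret pair_graph G by fact
  have len: "length (rev_path p) = length p" for p :: "('a \<times> 'a) list"
    by (induct p) auto
  have cost: "awalk_cost (\<lambda>_. 1) p = real (length p)" for p :: "('a \<times> 'a) list"
    by (simp add: awalk_cost_def sum_list_triv)
  have "{p. awalk v p u} = rev_path ` {p. awalk u p v}"
    by (auto intro!: image_eqI[where x = "rev_path _"])
  then have "\<mu> (\<lambda>_. 1) v u = \<mu> (\<lambda>_. 1) u v"
    unfolding \<mu>_def cost by (simp add: image_comp o_def len)
  then show ?thesis by (simp add: gdist_def)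
qed

lemma pair_graph_circulant:
  assumes "n > 0" and "\<And>s. s \<in> S \<Longrightarrow> \<not> n dvd s"
  shows "pair_graph (circulant n S)"
proof -
  have sub: "parcs (circulant n S) \<subseteq> {0..<n} \<times> {0..<n}"
    using \<open>n > 0\<close> by (auto simp: circulant_def)
  have neq: "(g + s) mod n \<noteq> g" if "g \<in> {0..<n}" "s \<in> S" for g s
  proof
    assume "(g + s) mod n = g"
    then have "(g + s) mod n = g mod n" using that by simp
    then have "n dvd s" by (simp add: mod_eq_dvd_iff)
    with assms(2) that show False by blast
  qed
  have verts: "pverts (circulant n S) = {0..<n}"
    by (simp add: circulant_def)
  show ?thesis
  proof unfold_locales
    show "finite (parcs (circulant n S))"
      using sub by (rule finite_subset) simp
    show "symmetric (with_proj (circulant n S))"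
      unfolding symmetric_def by (intro symI) (auto simp: circulant_def)
  next
    fix e assume "e \<in> parcs (circulant n S)"
    then show "fst e \<noteq> snd e"
      using neq by (fastforce simp: circulant_def)
  qed (use sub verts in auto)
qed

lemma pair_graph_compl:
  assumes "pair_graph G"
  shows "pair_graph (graph_compl G)"
proof -
  interpret pair_graph G by fact
  have sub: "parcs (graph_compl G) \<subseteq> pverts G \<times> pverts G"
    by (auto simp: graph_compl_def)
  have verts: "pverts (graph_compl G) = pverts G"
    by (simp add: graph_compl_def)
  show ?thesis
  proof unfold_locales
    show "finite (parcs (graph_compl G))"
      using sub by (rule finite_subset) (simp add: pair_finite_verts)
    show "symmetric (with_proj (graph_compl G))"
      unfolding symmetric_def
      by (intro symI) (auto simp: graph_compl_def dest: arcs_symmetric)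
  next
    fix e assume "e \<in> parcs (graph_compl G)"
    then show "fst e \<noteq> snd e"
      by (auto simp: graph_compl_def)
  qed (use sub verts pair_finite_verts in auto)
qed

lemma connected_compl_circulant:
  fixes n a :: int
  assumes "n \<ge> 8" and "2 \<le> a" and "real_of_int a < real_of_int n / 2" and "(n, a) \<noteq> (8, 3)"
  shows "Digraph_Component.connected (with_proj (graph_compl (circulant n {1, a})))"
proof -
  let ?C = "circulant n {1, a}"
  let ?G = "graph_compl ?C"
  have a: "2 * a < n" using assms(3) by linarith
  have "\<not> n dvd s" if "s \<in> {1, a}" for s
    using that a assms(1,2) by (auto dest: zdvd_imp_le)
  then interpret C: pair_graph ?C
    using assms(1) by (intro pair_graph_circulant) auto
  interpret G: pair_graph ?G
    by (intro pair_graph_compl) unfold_locales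
  define nb where "nb g = {(g + 1) mod n, (g - 1) mod n, (g + a) mod n, (g - a) mod n}" for g
  have nbI: "h \<in> nb g" if "(g, h) \<in> parcs ?C" for g h
  proof -
    have *: "x = ((x + s) mod n - s) mod n" if "x \<in> {0..<n}" for x s
      using that by (simp add: mod_diff_left_eq)
    show ?thesis using that *[of h 1] *[of h a]
      by (auto simp: circulant_def nb_def)
  qed
  have common: "\<exists>w\<in>{0..<n}. w \<noteq> u \<and> w \<noteq> v \<and> w \<notin> nb u \<and> w \<notin> nb v"
    if uv: "u \<in> {0..<n}" "v \<in> {0..<n}" and arc: "(u, v) \<in> parcs ?C" for u v
  proof -
    have mem: "v \<in> nb u" "u \<in> nb v"
      using arc C.arcs_symmetric nbI by blast+
    show ?thesis
    proof (cases "n = 8")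
      case True
      then have "a = 2" using a assms(2,4) by auto
      have Z8: "{0..<8::int} = {0, 1, 2, 3, 4, 5, 6, 7}" by auto
      have "\<forall>u\<in>{0, 1, 2, 3, 4, 5, 6, 7::int}. \<forall>v\<in>{(u + 1) mod 8, (u - 1) mod 8, (u + 2) mod 8, (u - 2) mod 8}.
        \<exists>w\<in>{0, 1, 2, 3, 4, 5, 6, 7}. w \<noteq> u \<and> w \<noteq> v
          \<and> w \<notin> {(u + 1) mod 8, (u - 1) mod 8, (u + 2) mod 8, (u - 2) mod 8}
          \<and> w \<notin> {(v + 1) mod 8, (v - 1) mod 8, (v + 2) mod 8, (v - 2) mod 8}"
        by simp
      then show ?thesis using mem(1) uv(1)
        unfolding nb_def \<open>n = 8\<close> \<open>a = 2\<close> Z8 by blast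
    next
      case False
      have "card (nb g) \<le> 4" for g
        using card_length[of "[(g + 1) mod n, (g - 1) mod n, (g + a) mod n, (g - a) mod n]"]
        by (simp add: nb_def)
      then have "card (nb u \<union> nb v) \<le> 8"
        using card_Un_le[of "nb u" "nb v"] by (smt (verit) add_mono numeral_Bit0 order.trans)
      moreover have "card {0..<n} > 8" using False assms(1) by simp
      moreover have "finite (nb u \<union> nb v)" by (simp add: nb_def)
      ultimately have "\<not> {0..<n} \<subseteq> nb u \<union> nb v"
        using card_mono[of "nb u \<union> nb v" "{0..<n}"] by linarith
      then obtain w where "w \<in> {0..<n}" "w \<notin> nb u" "w \<notin> nb v" by blast
      then show ?thesis using mem by (intro bexI[of _ w]) auto
    qed
  qed
  have reach: "u \<rightarrow>\<^sup>*\<^bsub>with_proj ?G\<^esub> v" if uv: "u \<in> {0..<n}" "v \<in> {0..<n}" for u v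
  proof -
    have verts: "pverts ?G = {0..<n}" by (simp add: graph_compl_def circulant_def)
    consider "u = v" | "(u, v) \<in> parcs ?G" | "(u, v) \<in> parcs ?C"
      using uv by (auto simp: graph_compl_def circulant_def)
    then show ?thesis
    proof cases
      case 1
      then show ?thesis using uv verts by simp
    next
      case 2
      then show ?thesis by (rule G.reachable_adjI)
    next
      case 3
      from common[OF uv this] obtain w where
        w: "w \<in> {0..<n}" "w \<noteq> u" "w \<noteq> v" "w \<notin> nb u" "w \<notin> nb v" by blast
      have "(u, w) \<notin> parcs ?C" "(v, w) \<notin> parcs ?C" using w nbI by blast+
      moreover have "pverts ?C = {0..<n}" by (simp add: circulant_def)
      ultimately have "(u, w) \<in> parcs ?G" "(v, w) \<in> parcs ?G"
        using w uv by (simp_all add: graph_compl_def)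
      then have "(u, w) \<in> parcs ?G" "(w, v) \<in> parcs ?G"
        by (simp_all add: G.arcs_symmetric)
      then show ?thesis
        using G.reachable_adjI G.reachable_trans by blast
    qed
  qed
  have "pverts ?G = {0..<n}" by (simp add: graph_compl_def circulant_def)
  then show ?thesis
    using assms(1) reach G.reachable_mk_symmetricI
    by (auto simp: Digraph_Component.connected_def strongly_connected_def)
qed

end

theory Submission
  imports Defs
begin

text \<open>
  In \<open>C\<^sub>n(1,a)\<close> every vertex has the four distinct neighbours \<open>g \<plusminus> 1\<close>, \<open>g \<plusminus> a\<close>, so the
  complement is regular of degree \<open>n - 5\<close> (lemma \<open>card_neighbours_circulant_1_a\<close>). The complement
  moreover has diameter two: if \<open>u\<close> and \<open>v\<close> are adjacent in \<open>C\<^sub>n(1,a)\<close>, both lie in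
  \<open>N(u) \<union> N(v)\<close>, and every vertex outside this union is a common neighbour of \<open>u\<close> and \<open>v\<close> in
  the complement. Such a vertex exists because the union has at most \<open>8 < n\<close> elements when
  \<open>n > 8\<close>, and at most \<open>7\<close> elements for \<open>C\<^sub>8(1,2)\<close>, where adjacent vertices share a neighbour
  (lemma \<open>circulant_1_a_avoid\<close>). In the excluded graph \<open>C\<^sub>8(1,3)\<close>, which is \<open>K\<^sub>4\<^sub>,\<^sub>4\<close>, the union
  is everything and the complement is disconnected.

  In a \<open>k\<close>-regular graph of order \<open>n\<close> and diameter two, each vertex sees \<open>k\<close> vertices at
  distance one and \<open>n - 1 - k\<close> at distance two. This determines the degrees, the transmissions
  and the reciprocal transmissions, which are therefore constant, and hence all seventeen
  indices, once sums over unordered pairs are replaced by half the sums over ordered pairs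
  (lemma \<open>upair_sum_double_count\<close>). The locale \<open>regular_diameter_two\<close> collects this part of
  the argument, which knows nothing about circulant graphs.
\<close>

section \<open>Sums over unordered pairs\<close>

text \<open>
  Each unordered pair \<open>{u, v}\<close> comes from exactly the two ordered pairs \<open>(u, v)\<close> and
  \<open>(v, u)\<close>.
\<close>

lemma upair_sum_double_count:
  assumes fin: "finite R" and sym: "sym R" and irr: "irrefl R"
    and f: "\<And>u v. (u, v) \<in> R \<Longrightarrow> f u v = f v u"
  shows "upair_sum f {{u, v} | u v. (u, v) \<in> R} = (\<Sum>(u, v)\<in>R. f u v) / 2"
proof -
  let ?p = "\<lambda>(u, v). {u, v}"
  let ?F = "\<lambda>e. THE y. \<exists>u v. e = {u, v} \<and> y = f u v"
  have P: "{{u, v} | u v. (u, v) \<in> R} = ?p ` R" by auto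
  have fibre: "(\<Sum>(u, v)\<in>{x \<in> R. ?p x = e}. f u v) = 2 * ?F e" if e: "e \<in> ?p ` R" for e
  proof -
    from e obtain u v where uv: "(u, v) \<in> R" "e = {u, v}" by auto
    have "u \<noteq> v" using uv(1) irr by (auto simp: irrefl_def)
    have "{x \<in> R. ?p x = e} = {(u, v), (v, u)}"
      using uv symD[OF sym] by (auto simp: doubleton_eq_iff)
    then show ?thesis
      using \<open>u \<noteq> v\<close> f[OF uv(1)] unfolding uv(2) by (simp add: upair_sum_summand)
  qed
  have "(\<Sum>(u, v)\<in>R. f u v) = (\<Sum>e\<in>?p ` R. \<Sum>(u, v)\<in>{x \<in> R. ?p x = e}. f u v)"
    by (rule sum.image_gen[OF fin])
  also have "\<dots> = 2 * upair_sum f (?p ` R)"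
    using fibre by (simp add: upair_sum_def sum_distrib_left)
  finally show ?thesis by (simp add: P)
qed


section \<open>Regular graphs of diameter two\<close>

locale regular_diameter_two = pair_graph G for G :: "'a pair_pre_digraph" +
  fixes k :: nat
  assumes regular: "u \<in> pverts G \<Longrightarrow> card {v. (u, v) \<in> parcs G} = k"
    and common_neighbour:
      "\<lbrakk>u \<in> pverts G; v \<in> pverts G; u \<noteq> v; (u, v) \<notin> parcs G\<rbrakk>
        \<Longrightarrow> \<exists>w. (u, w) \<in> parcs G \<and> (w, v) \<in> parcs G"
begin

abbreviation order :: real where
  "order \<equiv> real (card (pverts G))"

lemma deg_eq: "u \<in> pverts G \<Longrightarrow> deg G u = real k"
proof -
  assume u: "u \<in> pverts G"
  have "out_arcs (with_proj G) u = Pair u ` {v. (u, v) \<in> parcs G}"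
    by (auto simp: out_arcs_def)
  then show ?thesis
    using regular[OF u] by (simp add: deg_def out_degree_def card_image inj_on_def)
qed

lemma awalk_cost_one: "awalk_cost (\<lambda>_. 1) p = real (length p)"
  by (simp add: awalk_cost_def sum_list_triv)

lemma gdist_eq_shortest:
  assumes "awalk u p v" and "\<And>q. awalk u q v \<Longrightarrow> length p \<le> length q"
  shows "gdist G u v = real (length p)"
proof -
  have "\<mu> (\<lambda>_. 1) u v = ereal (real (length p))"
    unfolding \<mu>_def awalk_cost_one
    by (rule antisym) (use assms in \<open>auto intro!: INF_lower2 INF_greatest\<close>)
  then show ?thesis by (simp add: gdist_def)
qed

lemma gdist_adjacent:
  assumes "(u, v) \<in> parcs G"
  shows "gdist G u v = 1"
proof -
  have "awalk u [(u, v)] v" using assms by (simp add: awalk_simps in_arcsD1 in_arcsD2)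
  moreover have "1 \<le> length q" if "awalk u q v" for q
  proof (cases q)
    case Nil
    then show ?thesis using that assms no_loops by (fastforce simp: awalk_simps)
  qed simp
  ultimately show ?thesis using gdist_eq_shortest[of u "[(u, v)]" v] by simp
qed

lemma gdist_nonadjacent:
  assumes "u \<in> pverts G" "v \<in> pverts G" "u \<noteq> v" "(u, v) \<notin> parcs G"
  shows "gdist G u v = 2"
proof -
  from common_neighbour[OF assms] obtain w where w: "(u, w) \<in> parcs G" "(w, v) \<in> parcs G"
    by blast
  have "awalk u [(u, w), (w, v)] v" using w by (simp add: awalk_simps in_arcsD1 in_arcsD2)
  moreover have "2 \<le> length q" if q: "awalk u q v" for q
  proof (rule ccontr)
    assume "\<not> 2 \<le> length q"
    then consider "q = []" | e where "q = [e]"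
      by (cases q; cases "tl q") auto
    then show False using q assms by cases (auto simp: awalk_simps)
  qed
  ultimately show ?thesis using gdist_eq_shortest[of u "[(u, w), (w, v)]" v]
    by (simp add: numeral_eq_Suc)
qed

text \<open>
  The only fact about the metric that the indices use: a vertex has \<open>k\<close> others at distance one
  and the remaining ones at distance two.
\<close>

lemma sum_gdist:
  fixes h :: "real \<Rightarrow> real"
  assumes u: "u \<in> pverts G"
  shows "(\<Sum>v\<in>pverts G - {u}. h (gdist G u v)) = k * h 1 + (order - 1 - k) * h 2"
    (is "sum ?f _ = _")
proof -
  let ?N = "{v. (u, v) \<in> parcs G}"
  have sub: "?N \<subseteq> pverts G - {u}"
    using no_loops by (fastforce dest: in_arcsD2)
  have fin: "finite (pverts G - {u})" by (simp add: pair_finite_verts)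
  have "card (pverts G) > 0" using u pair_finite_verts by (auto simp: card_gt_0_iff)
  then have "real (card (pverts G - {u} - ?N)) = order - 1 - k"
    using regular[OF u] card_mono[OF fin sub] u pair_finite_verts
    by (simp add: card_Diff_subset[OF finite_subset[OF sub fin] sub] of_nat_diff)
  moreover have "sum ?f ?N = k * h 1"
    using regular[OF u] by (simp add: gdist_adjacent)
  moreover have "sum ?f (pverts G - {u} - ?N) = card (pverts G - {u} - ?N) * h 2"
  proof -
    have "sum ?f (pverts G - {u} - ?N) = (\<Sum>v\<in>pverts G - {u} - ?N. h 2)"
      using u by (intro sum.cong refl) (auto simp: gdist_nonadjacent)
    then show ?thesis by simp
  qed
  ultimately show ?thesis
    using sum.subset_diff[OF sub fin, of ?f] by simp
qed

lemma transmission_eq: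
  assumes "v \<in> pverts G"
  shows "transmission G v = 2 * (order - 1) - k"
  using sum_gdist[OF assms, of "\<lambda>d. d"]
  by (simp add: transmission_def gdist_commute[OF pair_graph_axioms, of _ v])

lemma recip_transmission_eq:
  assumes "v \<in> pverts G"
  shows "recip_transmission G v = (order - 1 + k) / 2"
  using sum_gdist[OF assms, of "\<lambda>d. 1 / d"]
  by (simp add: recip_transmission_def gdist_commute[OF pair_graph_axioms, of _ v] field_simps)

text \<open>
  The summand is only required to be a function of the distance on vertices of \<open>G\<close>. Degree weights
  are constant there, so the degree-weighted indices are covered too.
\<close>

lemma vertex_pairs_sum:
  fixes h :: "real \<Rightarrow> real"
  assumes f: "\<And>u v. \<lbrakk>u \<in> pverts G; v \<in> pverts G\<rbrakk> \<Longrightarrow> f u v = h (gdist G u v)"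
  shows "upair_sum f (vertex_pairs G) = order * (k * h 1 + (order - 1 - k) * h 2) / 2"
proof -
  let ?R = "Sigma (pverts G) (\<lambda>u. pverts G - {u})"
  have "vertex_pairs G = {{u, v} | u v. (u, v) \<in> ?R}"
    by (auto simp: vertex_pairs_def)
  moreover have "upair_sum f {{u, v} | u v. (u, v) \<in> ?R} = (\<Sum>(u, v)\<in>?R. f u v) / 2"
    by (rule upair_sum_double_count)
      (auto simp: pair_finite_verts sym_def irrefl_def f gdist_commute[OF pair_graph_axioms])
  moreover have "(\<Sum>(u, v)\<in>?R. f u v) = (\<Sum>u\<in>pverts G. \<Sum>v\<in>pverts G - {u}. h (gdist G u v))"
    by (simp add: sum.Sigma[symmetric] pair_finite_verts f)
  ultimately show ?thesis by (simp add: sum_gdist)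
qed

lemma uedges_sum:
  assumes f: "\<And>u v. (u, v) \<in> parcs G \<Longrightarrow> f u v = c"
  shows "upair_sum f (uedges G) = order * k / 2 * c"
proof -
  let ?S = "Sigma (pverts G) (\<lambda>u. {v. (u, v) \<in> parcs G})"
  have "finite {v. (u, v) \<in> parcs G}" for u
    by (rule finite_subset[OF _ pair_finite_verts]) (auto dest: in_arcsD2)
  then have "card ?S = (\<Sum>u\<in>pverts G. card {v. (u, v) \<in> parcs G})"
    by (intro card_SigmaI) (simp_all add: pair_finite_verts)
  moreover have "?S = parcs G" by (auto dest: in_arcsD1)
  ultimately have "card (parcs G) = (\<Sum>u\<in>pverts G. card {v. (u, v) \<in> parcs G})"
    by (simp only:)
  then have card: "real (card (parcs G)) = order * k" by (simp add: regular)
  have "sym (parcs G)" by (rule symI) (rule arcs_symmetric)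
  moreover have "irrefl (parcs G)" using no_loops by (fastforce simp: irrefl_def)
  ultimately have "upair_sum f (uedges G) = (\<Sum>(u, v)\<in>parcs G. f u v) / 2"
    unfolding uedges_def
    by (intro upair_sum_double_count) (auto simp: f pair_finite_arcs dest: symD)
  moreover have "(\<Sum>(u, v)\<in>parcs G. f u v) = (\<Sum>e\<in>parcs G. c)"
    by (rule sum.cong) (auto simp: f)
  ultimately show ?thesis by (simp add: card)
qed

text \<open>
  The transmission and the reciprocal transmission are both constant vertex weights, so the edge
  indices for either are those of an arbitrary constant \<open>c\<close>. The condition \<open>c > 1\<close> keeps the term
  \<open>w u + w v - 2\<close> of the indices ABC and AZ positive.
\<close>

context
  fixes w :: "'a \<Rightarrow> real" and c :: real
  assumes w: "\<And>u. u \<in> pverts G \<Longrightarrow> w u = c" and c: "c > 1"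
begin

lemma w_arc: "(u, v) \<in> parcs G \<Longrightarrow> w u = c" "(u, v) \<in> parcs G \<Longrightarrow> w v = c"
  using w by (auto dest: in_arcsD1 in_arcsD2)

lemma GA_index_const: "GA_index w G = order * k / 2"
  unfolding GA_index_def using c by (subst uedges_sum[where c = 1]) (simp_all add: w_arc)

lemma AG_index_const: "AG_index w G = order * k / 2"
  unfolding AG_index_def using c by (subst uedges_sum[where c = 1]) (simp_all add: w_arc)

lemma SC_index_const: "SC_index w G = order * k / (2 * sqrt 2 * sqrt c)"
  unfolding SC_index_def
  by (subst uedges_sum[where c = "1 / (sqrt 2 * sqrt c)"])
    (simp_all add: w_arc real_sqrt_mult[symmetric])

lemma ABC_index_const: "ABC_index w G = order * k * sqrt (c - 1) / (sqrt 2 * c)"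
proof -
  have "sqrt ((c + c - 2) / (c * c)) = 2 * sqrt (c - 1) / (sqrt 2 * c)"
  proof -
    have "sqrt ((c + c - 2) / (c * c)) = sqrt 2 * sqrt (c - 1) / c"
      using c by (simp add: real_sqrt_divide real_sqrt_mult[symmetric] algebra_simps)
    also have "sqrt 2 = 2 / sqrt (2::real)" by (simp add: real_div_sqrt)
    finally show ?thesis by simp
  qed
  then show ?thesis
    unfolding ABC_index_def
    by (subst uedges_sum[where c = "2 * sqrt (c - 1) / (sqrt 2 * c)"]) (simp_all add: w_arc)
qed

lemma AZ_index_const: "AZ_index w G = order * k * c ^ 6 / (16 * (c - 1) ^ 3)"
proof -
  have "c + c - 2 = 2 * (c - 1)" by simp
  then have "(c * c / (c + c - 2)) ^ 3 = (c ^ 3 * c ^ 3) / (2 ^ 3 * (c - 1) ^ 3)"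
    by (simp only: power_divide power_mult_distrib)
  also have "\<dots> = c ^ 6 / (8 * (c - 1) ^ 3)"
    by (simp flip: power_add)
  finally have "(c * c / (c + c - 2)) ^ 3 = c ^ 6 / (8 * (c - 1) ^ 3)" .
  then show ?thesis
    unfolding AZ_index_def
    by (subst uedges_sum[where c = "c ^ 6 / (8 * (c - 1) ^ 3)"]) (simp_all add: w_arc)
qed

end

end


section \<open>Neighbourhoods in circulant graphs and their complements\<close>

lemma neighbours_circulant:
  assumes "u \<in> {0..<n}"
  shows "{v. (u, v) \<in> parcs (circulant n S)} = (\<lambda>s. (u + s) mod n) ` (S \<union> uminus ` S)"
proof -
  have shift_inverse: "((g + s) mod n + - s) mod n = g" if "g \<in> {0..<n}" for g s
    using that by (simp add: mod_diff_left_eq)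
  have "n > 0" using assms by auto
  show ?thesis (is "?L = ?R")
  proof
    show "?L \<subseteq> ?R"
    proof
      fix v assume "v \<in> ?L"
      then consider s where "s \<in> S" "v = (u + s) mod n"
        | s where "s \<in> S" "v \<in> {0..<n}" "u = (v + s) mod n"
        by (auto simp: circulant_def)
      then show "v \<in> ?R"
      proof cases
        case 2
        then show ?thesis using shift_inverse[of v s] by (intro image_eqI[of _ _ "- s"]) auto
      qed auto
    qed
    show "?R \<subseteq> ?L"
    proof
      fix v assume "v \<in> ?R"
      then consider s where "s \<in> S" "v = (u + s) mod n"
        | s where "s \<in> S" "v = (u + - s) mod n"
        by auto
      then show "v \<in> ?L"
      proof cases
        case 1
        then show ?thesis using assms by (auto simp: circulant_def)
      next
        case 2
        then have "v \<in> {0..<n}" "(v + s) mod n = u"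
          using shift_inverse[OF assms, of "- s"] \<open>n > 0\<close> assms by (auto simp: mod_simps)
        then show ?thesis using 2(1) by (auto simp: circulant_def)
      qed
    qed
  qed
qed

text \<open>
  The differences of distinct elements of \<open>{1, -1, a, -a}\<close> are, up to sign, \<open>2\<close>, \<open>a - 1\<close>,
  \<open>a + 1\<close> and \<open>2 * a\<close>, all strictly between \<open>0\<close> and \<open>n\<close>.
\<close>

lemma card_neighbours_circulant_1_a:
  fixes n a :: int
  assumes "2 \<le> a" "2 * a < n" and u: "u \<in> {0..<n}"
  shows "card {v. (u, v) \<in> parcs (circulant n {1, a})} = 4"
proof -
  let ?D = "{1, a} \<union> uminus ` {1, a}"
  have "inj_on (\<lambda>s. (u + s) mod n) ?D"
  proof (rule inj_onI)
    fix s t assume st: "s \<in> ?D" "t \<in> ?D" and "(u + s) mod n = (u + t) mod n"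
    then have "n dvd s - t" by (simp add: mod_eq_dvd_iff)
    moreover have "\<bar>s - t\<bar> < n" using st assms(1,2) by auto
    ultimately show "s = t"
      using zdvd_not_zless[of "\<bar>s - t\<bar>" n] by auto
  qed
  moreover have "card ?D = 4" using assms(1) by auto
  ultimately show ?thesis
    unfolding neighbours_circulant[OF u] by (simp only: card_image)
qed

text \<open>
  Two neighbourhoods have at most eight elements together, which settles \<open>n > 8\<close>. For \<open>n = 8\<close>
  this leaves no slack, but then \<open>a = 2\<close> and the neighbourhoods of adjacent vertices overlap: \<open>u\<close>
  and \<open>u \<plusminus> 1\<close> share \<open>u \<plusminus> 2\<close>, and \<open>u\<close> and \<open>u \<plusminus> 2\<close> share \<open>u \<plusminus> 1\<close>.
\<close>

lemma circulant_1_a_avoid: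
  fixes n a :: int
  assumes "n \<ge> 8" "2 \<le> a" "2 * a < n" "(n, a) \<noteq> (8, 3)"
    and uv: "(u, v) \<in> parcs (circulant n {1, a})" "u \<in> {0..<n}" "v \<in> {0..<n}"
  shows "\<exists>w\<in>{0..<n}. (u, w) \<notin> parcs (circulant n {1, a}) \<and> (v, w) \<notin> parcs (circulant n {1, a})"
proof -
  define N where "N g = {w. (g, w) \<in> parcs (circulant n {1, a})}" for g
  have card4: "card (N g) = 4" if "g \<in> {0..<n}" for g
    unfolding N_def using card_neighbours_circulant_1_a assms(2,3) that by blast
  have fin: "finite (N g)" if "g \<in> {0..<n}" for g
    using card4[OF that] card.infinite by fastforce
  have "card (N u \<union> N v) + card (N u \<inter> N v) = 8"
    using card_Un_Int[OF fin fin] card4 uv(2,3) by simp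
  moreover have "n > 8 \<or> card (N u \<inter> N v) > 0"
  proof (cases "n = 8")
    case True
    then have "a = 2" using assms(2-4) by auto
    have N8: "N g = (\<lambda>s. (g + s) mod 8) ` {1, 2, - 1, - 2}" if "g \<in> {0..<n}" for g
      using neighbours_circulant[OF that, of "{1, a}"] unfolding N_def True \<open>a = 2\<close> by auto
    have "v \<in> N u" using uv(1) by (simp add: N_def)
    then obtain s where s: "s \<in> {1, 2, - 1, - 2}" "v = (u + s) mod 8"
      unfolding N8[OF uv(2)] by blast
    obtain d where d: "d \<in> {1, 2, - 1, - 2}" "s + d \<in> {1, 2, - 1, - 2::int}"
    proof -
      have "1 + 1 = (2::int)" "2 + - 1 = (1::int)" "- 1 + - 1 = (- 2::int)" "- 2 + 1 = (- 1::int)"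
        by simp_all
      then show thesis using that s(1) by (metis insert_iff empty_iff)
    qed
    have "(v + d) mod 8 = (u + (s + d)) mod 8"
      unfolding s(2) by (simp add: mod_add_left_eq add.assoc)
    then have "(u + (s + d)) mod 8 \<in> N u \<inter> N v"
      using d N8[OF uv(2)] N8[OF uv(3)] by (metis IntI imageI)
    then show ?thesis using fin[OF uv(2)] by (auto simp: card_gt_0_iff)
  qed (use assms(1) in auto)
  ultimately have "card (N u \<union> N v) < card {0..<n}" using assms(1) by auto
  then have "\<not> {0..<n} \<subseteq> N u \<union> N v"
    using card_mono[of "N u \<union> N v" "{0..<n}"] fin uv(2,3) by auto
  then show ?thesis by (auto simp: N_def)
qed

lemma regular_diameter_two_compl_circulant:
  fixes n a :: int
  assumes "n \<ge> 8" "2 \<le> a" "2 * a < n" "(n, a) \<noteq> (8, 3)"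
  shows "regular_diameter_two (graph_compl (circulant n {1, a})) (nat n - 5)"
proof -
  let ?C = "circulant n {1, a}"
  let ?G = "graph_compl ?C"
  have "\<not> n dvd s" if "s \<in> {1, a}" for s
    using that assms(1-3) by (auto dest: zdvd_imp_le)
  then interpret C: pair_graph ?C
    using assms(1) by (intro pair_graph_circulant) auto
  interpret G: pair_graph ?G
    by (intro pair_graph_compl) unfold_locales
  have vertsC: "pverts ?C = {0..<n}" by (simp add: circulant_def)
  have verts: "pverts ?G = {0..<n}" by (simp add: graph_compl_def vertsC)
  show ?thesis
  proof unfold_locales
    fix u assume u: "u \<in> pverts ?G"
    let ?N = "{v. (u, v) \<in> parcs ?C}"
    have "card ?N = 4"
      using card_neighbours_circulant_1_a assms(2,3) u verts by blast
    moreover have "?N \<subseteq> {0..<n} - {u}"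
      using C.no_loops by (fastforce dest: C.in_arcsD2 simp: vertsC)
    moreover have "finite ?N" using calculation(2) by (rule finite_subset) simp
    moreover have "{v. (u, v) \<in> parcs ?G} = {0..<n} - {u} - ?N"
      using u by (auto simp: graph_compl_def vertsC)
    ultimately show "card {v. (u, v) \<in> parcs ?G} = nat n - 5"
      using u verts by (simp add: card_Diff_subset)
  next
    fix u v assume uv: "u \<in> pverts ?G" "v \<in> pverts ?G" "u \<noteq> v" "(u, v) \<notin> parcs ?G"
    then have arc: "(u, v) \<in> parcs ?C" "(v, u) \<in> parcs ?C"
      using C.arcs_symmetric by (auto simp: graph_compl_def)
    obtain w where w: "w \<in> {0..<n}" "(u, w) \<notin> parcs ?C" "(v, w) \<notin> parcs ?C"
      using circulant_1_a_avoid[OF assms arc(1)] uv(1,2) verts by blast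
    then have "w \<noteq> u" "w \<noteq> v" using arc by auto
    then have "(u, w) \<in> parcs ?G" "(v, w) \<in> parcs ?G"
      using w uv(1,2) by (auto simp: graph_compl_def vertsC)
    then show "\<exists>w. (u, w) \<in> parcs ?G \<and> (w, v) \<in> parcs ?G"
      using G.arcs_symmetric by blast
  qed
qed


section \<open>The indices of the complement\<close>

theorem corollary4p9:
  fixes n a :: int
  assumes "n \<ge> 8"
    and "2 \<le> a"
    and "real_of_int a < real_of_int n / 2"
    and "(n, a) \<noteq> (8, 3)"
  shows "let G = graph_compl (circulant n {1, a}); N = real_of_int n in
      wiener G = N * (N + 3) / 2
    \<and> schultz G = N * (N - 5) * (N + 3)
    \<and> gutman G = N * (N + 3) * (N - 5)\<^sup>2 / 2
    \<and> hyper_wiener G = N * (2 * N + 14) / 4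
    \<and> harary G = N * (N - 3) / 2
    \<and> harary_add G = N * (N - 5) * (N - 3)
    \<and> harary_mult G = N * (N - 3) * (N - 5)\<^sup>2 / 2
    \<and> T_AG G = N * (N - 5) / 2
    \<and> T_GA G = N * (N - 5) / 2
    \<and> T_SC G = N * (N - 5) / (2 * sqrt 2 * sqrt (N + 3))
    \<and> T_ABC G = N * (N - 5) * sqrt (N + 2) / (sqrt 2 * (N + 3))
    \<and> T_AZ G = N * (N - 5) * (N + 3) ^ 6 / (16 * (N + 2) ^ 3)
    \<and> RT_AG G = N * (N - 5) / 2
    \<and> RT_GA G = N * (N - 5) / 2
    \<and> RT_SC G = N * (N - 5) / (2 * sqrt 2 * sqrt (N - 3))
    \<and> RT_ABC G = N * (N - 5) * sqrt (N - 4) / (sqrt 2 * (N - 3))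
    \<and> RT_AZ G = N * (N - 5) * (N - 3) ^ 6 / (16 * (N - 4) ^ 3)"
proof -
  define G where "G = graph_compl (circulant n {1, a})"
  define N where "N = real_of_int n"
  have "2 * a < n" using assms(3) by linarith
  then interpret regular_diameter_two G "nat n - 5"
    unfolding G_def using assms regular_diameter_two_compl_circulant by blast
  have "pverts G = {0..<n}" by (simp add: G_def graph_compl_def circulant_def)
  then have order: "order = N" using assms(1) by (simp add: N_def)
  have k: "real (nat n - 5) = N - 5" using assms(1) by (simp add: N_def of_nat_diff)
  have N: "N \<ge> 8" using assms(1) by (simp add: N_def)
  note pairs = vertex_pairs_sum[unfolded order k]
  have d: "deg G u = N - 5" if "u \<in> pverts G" for u
    using deg_eq[OF that] k by simp
  have t: "transmission G u = N + 3" if "u \<in> pverts G" for u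
    using transmission_eq[OF that] k order by simp
  have r: "recip_transmission G u = N - 3" if "u \<in> pverts G" for u
    using recip_transmission_eq[OF that] k order by simp
  have "wiener G = N * (N + 3) / 2"
    unfolding wiener_def by (subst pairs[where h = "\<lambda>x. x"]) (simp_all add: algebra_simps)
  moreover have "schultz G = N * (N - 5) * (N + 3)"
    unfolding schultz_def
    by (subst pairs[where h = "\<lambda>x. 2 * (N - 5) * x"]) (simp_all add: d field_simps)
  moreover have "gutman G = N * (N + 3) * (N - 5)\<^sup>2 / 2"
    unfolding gutman_def
    by (subst pairs[where h = "\<lambda>x. (N - 5)\<^sup>2 * x"]) (simp_all add: d field_simps power2_eq_square)
  moreover have "hyper_wiener G = N * (2 * N + 14) / 4"
    unfolding hyper_wiener_def
    by (subst pairs[where h = "\<lambda>x. x + x\<^sup>2"]) (simp_all add: field_simps)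
  moreover have "harary G = N * (N - 3) / 2"
    unfolding harary_def by (subst pairs[where h = "\<lambda>x. 1 / x"]) (simp_all add: field_simps)
  moreover have "harary_add G = N * (N - 5) * (N - 3)"
    unfolding harary_add_def
    by (subst pairs[where h = "\<lambda>x. 2 * (N - 5) / x"]) (simp_all add: d field_simps)
  moreover have "harary_mult G = N * (N - 3) * (N - 5)\<^sup>2 / 2"
    unfolding harary_mult_def
    by (subst pairs[where h = "\<lambda>x. (N - 5)\<^sup>2 / x"]) (simp_all add: d field_simps power2_eq_square)
  moreover
  have c: "N + 3 > 1" "N + 3 - 1 = N + 2" "N - 3 > 1" "N - 3 - 1 = N - 4" using N by simp_all
  note
    T = AG_index_const[of "transmission G" "N + 3", OF t c(1)]
      GA_index_const[of "transmission G" "N + 3", OF t c(1)]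
      SC_index_const[of "transmission G" "N + 3", OF t c(1)]
      ABC_index_const[of "transmission G" "N + 3", OF t c(1)]
      AZ_index_const[of "transmission G" "N + 3", OF t c(1)] and
    RT = AG_index_const[of "recip_transmission G" "N - 3", OF r c(3)]
      GA_index_const[of "recip_transmission G" "N - 3", OF r c(3)]
      SC_index_const[of "recip_transmission G" "N - 3", OF r c(3)]
      ABC_index_const[of "recip_transmission G" "N - 3", OF r c(3)]
      AZ_index_const[of "recip_transmission G" "N - 3", OF r c(3)]
  note T[unfolded order k c(2), folded T_AG_def T_GA_def T_SC_def T_ABC_def T_AZ_def]
    RT[unfolded order k c(4), folded RT_AG_def RT_GA_def RT_SC_def RT_ABC_def RT_AZ_def]
  ultimately show ?thesis
    unfolding Let_def G_def[symmetric] N_def[symmetric] by (intro conjI)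
qed

end
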